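(* Let $Q(v_a,v_b,v_c,v_d)$ be a hyperbolic Lambert quadrilateral in the unit disk $\mathbb{B}^2$, and let the quadruple of interior angles $(\frac{\pi}{2},\frac{\pi}{2},\phi,\frac{\pi}{2})$, $\phi\in[0,\pi/2)$, correspond to the quadruple $(v_a,v_b,v_c,v_d)$ of vertices. Let $d_1=d_\rho(J[v_a,v_d],J[v_b,v_c])$, $d_2=d_\rho(J[v_a,v_b],J[v_c,v_d])$, and let $L=\tanh\rho(v_a,v_c)\in(0,1]$. Then $$d_1d_2\le\left(\operatorname{artanh}\left(\frac{\sqrt2}{2}L\right)\right)^2.$$ Equality holds if and only if $v_c$ is on the bisector of the interior angle at $v_a$.
   Context: $\mathbb{B}^2$ is the open unit disk in the plane with the hyperbolic metric $\rho$ of weight $2/(1-|x|^2)$, i.e. $\tanh\frac{\rho(x,y)}{2}=\frac{|x-y|}{\sqrt{|x-y|^2+(1-|x|^2)(1-|y|^2)}}$. Hyperbolic geodesic lines are the sets $C\cap\mathbb{B}^2$ where $C$ is a circle perpendicular to the unit circle or a Euclidean line through $0$. $J[a,b]$ is the hyperbolic geodesic segment joining $a$ and $b$ when $a,b\in\mathbb{B}^2$, or the hyperbolic geodesic ray when one of the two points is on $\partial\mathbb{B}^2$. For nonempty $A,B\subset\mathbb{B}^2$, $d_\rho(A,B)=\inf_{x\in A,\,y\in B}\rho(x,y)$. A hyperbolic quadrilateral $Q(a,b,c,d)$ is given by four points of the closed unit disk such that the hyperbolic geodesics joining $\{a,b\},\{b,c\},\{c,d\},\{d,a\}$ bound a domain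 $D\subset\mathbb{B}^2$ with $a,b,c,d$ in positive order on the boundary of $D$. It is a Lambert quadrilateral if its angles are $\pi/2,\pi/2,\pi/2,\phi$ with $0\le\phi<\pi/2$; the vertex with angle $\phi$ may be on the unit circle, in which case $\phi=0$. If $v_c\in\partial\mathbb{B}^2$, then $\rho(v_a,v_c)=\infty$ and $L=1$. *)

theory Defs
  imports "HOL-Complex_Analysis.Complex_Analysis"
begin

text \<open>The hyperbolic plane is the open unit disk \<open>ball 0 1\<close> of \<open>complex\<close>; ideal points are the
  points of \<open>sphere 0 1\<close>.\<close>

text \<open>Hyperbolic distance for the density \<open>2 / (1 - |x|^2)\<close>. It is meaningful for points of the open
  disk only.\<close>

definition hyp_dist :: "complex \<Rightarrow> complex \<Rightarrow> real" where
  "hyp_dist x y =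
     2 * artanh (cmod (x - y) /
       sqrt ((cmod (x - y))\<^sup>2 + (1 - (cmod x)\<^sup>2) * (1 - (cmod y)\<^sup>2)))"

definition hyp_setdist :: "complex set \<Rightarrow> complex set \<Rightarrow> real" where
  "hyp_setdist A B = Inf {hyp_dist x y | x y. x \<in> A \<and> y \<in> B}"

definition perp_unit_circle :: "complex \<Rightarrow> real \<Rightarrow> bool" where
  "perp_unit_circle m r \<longleftrightarrow>
     0 < r \<and> sphere m r \<inter> sphere 0 1 \<noteq> {} \<and>
     (\<forall>p \<in> sphere m r \<inter> sphere 0 1. orthogonal (p - m) p)"

definition hyp_line :: "complex set \<Rightarrow> bool" where
  "hyp_line l \<longleftrightarrow>
     (\<exists>m r. perp_unit_circle m r \<and> l = sphere m r \<inter> ball 0 1) \<or>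
     (\<exists>u. u \<noteq> 0 \<and> l = span {u} \<inter> ball 0 1)"

text \<open>For distinct points \<open>a, b\<close> of the closed disk there is exactly one hyperbolic line whose closure
  contains both. This closure is an arc, so the part of it between \<open>a\<close> and \<open>b\<close> is the smallest
  connected subset containing them. Ideal end points do not belong to \<open>hyp_seg a b\<close>, which is
  therefore a segment, a ray, or a full line.\<close>

definition hyp_seg :: "complex \<Rightarrow> complex \<Rightarrow> complex set" where
  "hyp_seg a b =
     {z \<in> ball 0 1. \<forall>l K. hyp_line l \<and> K \<subseteq> closure l \<and> connected K \<and> a \<in> K \<and> b \<in> K \<longrightarrow> z \<in> K}"

text \<open>Here \<open>g\<close> runs along the geodesic from \<open>x\<close> to \<open>y\<close>, ideal end points included.\<close>

definition side_path :: "(real \<Rightarrow> complex) \<Rightarrow> complex \<Rightarrow> complex \<Rightarrow> bool" where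
  "side_path g x y \<longleftrightarrow>
     arc g \<and> pathstart g = x \<and> pathfinish g = y \<and> path_image g = insert x (insert y (hyp_seg x y))"

text \<open>Positive order of the vertices means that the boundary curve, run through in this order, winds
  once counterclockwise around the points of the domain.\<close>

definition hyp_quadrilateral :: "complex \<Rightarrow> complex \<Rightarrow> complex \<Rightarrow> complex \<Rightarrow> bool" where
  "hyp_quadrilateral a b c d \<longleftrightarrow>
     {a, b, c, d} \<subseteq> cball 0 1 \<and>
     (\<exists>g1 g2 g3 g4 g D.
        side_path g1 a b \<and> side_path g2 b c \<and> side_path g3 c d \<and> side_path g4 d a \<and>
        g = g1 +++ g2 +++ g3 +++ g4 \<and> simple_path g \<and>
        open D \<and> connected D \<and> D \<noteq> {} \<and> D \<subseteq> ball 0 1 \<and> frontier D = path_image g \<and>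
        (\<forall>z \<in> D. winding_number g z = 1))"

text \<open>Unit tangent vector at \<open>x\<close> of the geodesic from \<open>x\<close> to \<open>y\<close>; \<open>x\<close> may be ideal.\<close>

definition hyp_dir :: "complex \<Rightarrow> complex \<Rightarrow> complex" where
  "hyp_dir x y = Lim (at x within hyp_seg x y) (\<lambda>z. sgn (z - x))"

text \<open>Interior angle at the vertex \<open>v\<close>, where \<open>p\<close> precedes and \<open>n\<close> follows \<open>v\<close> in the positive order
  of the vertices. The domain lies to the left of the boundary curve, so the angle is measured
  counterclockwise from the side towards \<open>n\<close> to the side towards \<open>p\<close>. At an ideal vertex both
  directions agree and the angle is 0.\<close>

definition interior_angle :: "complex \<Rightarrow> complex \<Rightarrow> complex \<Rightarrow> real" where
  "interior_angle p v n = Arg2pi (hyp_dir v p / hyp_dir v n)"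

text \<open>The hyperbolic ray from \<open>v\<close>, ideal end point included, that halves this angle.\<close>

definition interior_bisector :: "complex \<Rightarrow> complex \<Rightarrow> complex \<Rightarrow> complex set" where
  "interior_bisector p v n =
     insert v {z \<in> cball 0 1. z \<noteq> v \<and> hyp_dir v z = hyp_dir v n * cis (interior_angle p v n / 2)}"

text \<open>Only \<open>c\<close>, the vertex with angle \<open>\<phi>\<close>, may be ideal.\<close>

definition lambert_quadrilateral ::
    "complex \<Rightarrow> complex \<Rightarrow> complex \<Rightarrow> complex \<Rightarrow> real \<Rightarrow> bool" where
  "lambert_quadrilateral a b c d \<phi> \<longleftrightarrow>
     hyp_quadrilateral a b c d \<and> {a, b, d} \<subseteq> ball 0 1 \<and>
     interior_angle d a b = pi / 2 \<and> interior_angle a b c = pi / 2 \<and>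
     interior_angle b c d = \<phi> \<and> interior_angle c d a = pi / 2 \<and>
     0 \<le> \<phi> \<and> \<phi> < pi / 2"

text \<open>\<open>tanh\<close> of the distance from a point \<open>x\<close> of the open disk to a point \<open>y\<close> of the closed disk;
  ideal points are at infinite distance.\<close>

definition tanh_hyp_dist :: "complex \<Rightarrow> complex \<Rightarrow> real" where
  "tanh_hyp_dist x y = (if y \<in> sphere 0 1 then 1 else tanh (hyp_dist x y))"

end

theory Submission
  imports Defs
begin

text \<open>A Moebius transformation of the disk takes \<open>v\<^sub>a\<close> to \<open>0\<close> and \<open>v\<^sub>b\<close> to the positive real axis. The
  right angles then put \<open>v\<^sub>d\<close> on the positive imaginary axis, and the image \<open>c\<close> of \<open>v\<^sub>c\<close> on the
  perpendiculars to the axes at \<open>v\<^sub>b\<close> and \<open>v\<^sub>d\<close>. The distances of opposite sides are attained on the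
  axes, so in the Klein coordinates \<open>(p, q) = 2 c / (1 + |c|\<^sup>2)\<close> of \<open>c\<close> they are \<open>artanh p\<close> and
  \<open>artanh q\<close>, while \<open>L\<^sup>2 = p\<^sup>2 + q\<^sup>2\<close>. What remains is that \<open>artanh p * artanh q\<close> is largest, among
  positive \<open>p, q\<close> on this circle, exactly on the diagonal \<open>p = q\<close>.\<close>

section \<open>Moebius transformations and geodesics\<close>

lemma Moebius_denom_nonzero:
  assumes "cmod a < 1" "cmod z \<le> 1"
  shows "1 - cnj a * z \<noteq> 0"
proof
  assume "1 - cnj a * z = 0"
  then have "cmod (cnj a * z) = 1" by (metis eq_iff_diff_eq_0 norm_one)
  moreover have "cmod (cnj a * z) \<le> cmod a * 1"
    unfolding norm_mult complex_mod_cnj using assms by (intro mult_left_mono) auto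
  ultimately show False using assms by linarith
qed

lemma norm_Moebius: "cmod (Moebius_function t a z) = cmod (z - a) / cmod (1 - cnj a * z)"
  by (simp add: Moebius_function_def norm_divide norm_mult)

text \<open>Divide \<open>|1 - cnj a * z|^2 - |z - a|^2 = (1 - |a|^2) * (1 - |z|^2)\<close> by the
  squared denominator. The formula shows that disk and circle are preserved, and later it computes a
  distance exactly.\<close>

lemma one_minus_norm_Moebius:
  assumes "cmod a < 1" "cmod z \<le> 1"
  shows "1 - (cmod (Moebius_function t a z))\<^sup>2 =
    (1 - (cmod a)\<^sup>2) * (1 - (cmod z)\<^sup>2) / (cmod (1 - cnj a * z))\<^sup>2"
proof -
  have nz: "cmod (1 - cnj a * z) \<noteq> 0" using Moebius_denom_nonzero[OF assms] by simp
  have "(cmod (1 - cnj a * z))\<^sup>2 - (cmod (z - a))\<^sup>2 = (1 - (cmod a)\<^sup>2) * (1 - (cmod z)\<^sup>2)"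
    unfolding cmod_power2 by (simp add: power2_eq_square algebra_simps)
  then show ?thesis
    using nz by (simp add: norm_Moebius power_divide diff_divide_eq_iff)
qed

lemma Moebius_norm_less_iff:
  assumes "cmod a < 1" "cmod z \<le> 1"
  shows "cmod (Moebius_function t a z) < 1 \<longleftrightarrow> cmod z < 1"
    and "cmod (Moebius_function t a z) \<le> 1"
proof -
  define q where "q = (1 - (cmod a)\<^sup>2) / (cmod (1 - cnj a * z))\<^sup>2"
  have q: "q > 0"
    using assms Moebius_denom_nonzero[OF assms]
    by (auto simp: q_def abs_square_less_1 intro!: divide_pos_pos)
  have eq: "1 - (cmod (Moebius_function t a z))\<^sup>2 = q * (1 - (cmod z)\<^sup>2)"
    using one_minus_norm_Moebius[OF assms] by (simp add: q_def)
  have "(cmod z)\<^sup>2 \<le> 1" using assms by (simp add: abs_square_le_1)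
  then have "0 \<le> 1 - (cmod (Moebius_function t a z))\<^sup>2"
    unfolding eq using q by simp
  then show "cmod (Moebius_function t a z) \<le> 1"
    by (simp add: abs_square_le_1)
  have "(cmod (Moebius_function t a z))\<^sup>2 < 1 \<longleftrightarrow> 0 < q * (1 - (cmod z)\<^sup>2)"
    using eq by linarith
  also have "\<dots> \<longleftrightarrow> (cmod z)\<^sup>2 < 1" using q by (simp add: zero_less_mult_iff)
  finally show "cmod (Moebius_function t a z) < 1 \<longleftrightarrow> cmod z < 1"
    by (simp add: abs_square_less_1)
qed

text \<open>The inverse rotates back by \<open>- t\<close>, and its centre must be the image
  \<open>- exp (\<i> * of_real t) * a\<close> of 0, since that is the point it sends to 0.\<close>

lemma Moebius_inverse:
  assumes "cmod a < 1" "cmod z \<le> 1"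
  shows "Moebius_function (- t) (- (exp (\<i> * of_real t) * a)) (Moebius_function t a z) = z"
proof -
  define e where "e = exp (\<i> * of_real t)"
  have e: "e * cnj e = 1" "exp (\<i> * of_real (- t)) = cnj e"
    unfolding e_def by (simp_all add: exp_cnj exp_minus flip: exp_add)
  have nz: "1 - cnj a * z \<noteq> 0" by (rule Moebius_denom_nonzero[OF assms])
  have nza: "1 - cnj a * a \<noteq> 0" by (rule Moebius_denom_nonzero) (use assms in auto)
  \<comment> \<open>Numerator and denominator of the composed fraction share the factor
    \<open>(1 - cnj a * a) / (1 - cnj a * z)\<close>, and what is left of the quotient is
    \<open>z\<close>.\<close>
  have 1: "cnj e * (e * (z - a) / (1 - cnj a * z) + e * a) = z * (1 - cnj a * a) / (1 - cnj a * z)"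
    using nz e(1) by (simp add: divide_simps) (algebra)
  have 2: "1 + cnj e * cnj a * (e * (z - a) / (1 - cnj a * z)) = (1 - cnj a * a) / (1 - cnj a * z)"
    using nz e(1) by (simp add: divide_simps) (algebra)
  have "Moebius_function (- t) (- (e * a)) (Moebius_function t a z) =
     cnj e * (e * (z - a) / (1 - cnj a * z) + e * a) / (1 + cnj e * cnj a * (e * (z - a) / (1 - cnj a * z)))"
    by (simp add: Moebius_function_def e(2)[simplified] flip: e_def)
  also have "\<dots> = z" unfolding 1 2 using nz nza by simp
  finally show ?thesis by (simp add: e_def)
qed

text \<open>Inverting the parameters twice gives \<open>a\<close> and \<open>t\<close> back, so the
  left inverse is also a right inverse.\<close>

lemma Moebius_inverse_right:
  assumes "cmod a < 1" "cmod z \<le> 1"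
  shows "Moebius_function t a (Moebius_function (- t) (- (exp (\<i> * of_real t) * a)) z) = z"
proof -
  have "exp (\<i> * of_real (- t)) * (exp (\<i> * of_real t) * a) = a"
    by (simp add: exp_minus)
  moreover have "cmod (- (exp (\<i> * of_real t) * a)) < 1" using assms by (simp add: norm_mult)
  ultimately show ?thesis
    using Moebius_inverse[of "- (exp (\<i> * of_real t) * a)" z "- t"] assms
    by (simp only: mult_minus_right minus_minus)
qed

lemma continuous_on_Moebius:
  assumes "cmod a < 1"
  shows "continuous_on (cball 0 1) (Moebius_function t a)"
  unfolding Moebius_function_def
  by (intro continuous_intros) (use Moebius_denom_nonzero[OF assms] in auto)

text \<open>Lines and circles orthogonal to the unit circle are treated uniformly as zero sets of
  Hermitian forms of signature \<open>(1, 1)\<close>, which Moebius transformations permute.\<close>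

definition hermitian_line :: "real \<Rightarrow> complex \<Rightarrow> complex set" where
  "hermitian_line \<alpha> m = {z. \<alpha> * ((cmod z)\<^sup>2 + 1) = 2 * Re (z * cnj m)}"

lemma closed_hermitian_line: "closed (hermitian_line \<alpha> m)"
  unfolding hermitian_line_def by (intro closed_Collect_eq continuous_intros)

text \<open>Expanding \<open>|z - c|^2 = r^2\<close> leaves the constant term
  \<open>|c|^2 - r^2\<close>, which orthogonality to the unit circle makes equal to 1.\<close>

lemma sphere_eq_hermitian_line:
  assumes "(cmod c)\<^sup>2 = 1 + r\<^sup>2" "0 < r"
  shows "sphere c r = hermitian_line 1 c"
proof -
  have "z \<in> sphere c r \<longleftrightarrow> (cmod (z - c))\<^sup>2 = r\<^sup>2" for z
    using assms(2) by (simp add: dist_norm norm_minus_commute)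
  moreover have "(cmod (z - c))\<^sup>2 = (cmod z)\<^sup>2 + (cmod c)\<^sup>2 - 2 * Re (z * cnj c)" for z
    unfolding cmod_power2 by (simp add: power2_eq_square algebra_simps)
  ultimately show ?thesis using assms(1) by (auto simp: hermitian_line_def)
qed

lemma span_eq_hermitian_line:
  assumes "u \<noteq> 0"
  shows "span {u} = hermitian_line 0 (\<i> * u)"
proof
  show "span {u} \<subseteq> hermitian_line 0 (\<i> * u)"
    by (auto simp: span_singleton hermitian_line_def)
  show "hermitian_line 0 (\<i> * u) \<subseteq> span {u}"
  proof
    fix z assume "z \<in> hermitian_line 0 (\<i> * u)"
    then have "Im (z * cnj u) = 0" by (simp add: hermitian_line_def algebra_simps)
    then have "z * cnj u = of_real (Re (z * cnj u))" by (simp add: complex_eq_iff)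
    then have "z * (u * cnj u) = of_real (Re (z * cnj u)) * u" by (metis mult.assoc mult.commute)
    then have "z = of_real (Re (z * cnj u) / (cmod u)\<^sup>2) * u"
      using assms by (simp add: complex_norm_square[symmetric] field_simps)
    then have "z = (Re (z * cnj u) / (cmod u)\<^sup>2) *\<^sub>R u" by (simp only: scaleR_conv_of_real)
    then show "z \<in> span {u}" unfolding span_singleton by blast
  qed
qed

text \<open>This is Pythagoras for the triangle with vertices 0, \<open>m\<close> and a common point
  \<open>p\<close> of the two circles, where the right angle sits at \<open>p\<close>.\<close>

lemma perp_unit_circle_iff:
  "perp_unit_circle m r \<longleftrightarrow> 0 < r \<and> (cmod m)\<^sup>2 = 1 + r\<^sup>2"
proof
  assume *: "perp_unit_circle m r"
  then obtain p where p: "p \<in> sphere m r" "p \<in> sphere 0 1" "orthogonal (p - m) p"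
    unfolding perp_unit_circle_def by blast
  have "(cmod (p - m))\<^sup>2 = r\<^sup>2" "(cmod p)\<^sup>2 = 1"
    using p by (auto simp: dist_norm norm_minus_commute)
  with p(3) show "0 < r \<and> (cmod m)\<^sup>2 = 1 + r\<^sup>2"
    using * unfolding perp_unit_circle_def orthogonal_def inner_complex_def cmod_power2
    by (simp add: power2_eq_square) argo
next
  assume *: "0 < r \<and> (cmod m)\<^sup>2 = 1 + r\<^sup>2"
  \<comment> \<open>A common point has to be exhibited: \<open>p\<close> is a point where a tangent
    from \<open>m\<close> touches the unit circle, characterised by
    \<open>p * cnj m = 1 + \<i> * of_real r\<close>.\<close>
  define p where "p = (1 + \<i> * of_real r) * m / of_real (1 + r\<^sup>2)"
  have m: "m \<noteq> 0" using * by (auto simp: add_nonneg_eq_0_iff)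
  have r: "1 + r\<^sup>2 \<noteq> 0" by (simp add: add_nonneg_eq_0_iff)
  have "(cmod p)\<^sup>2 = (1 + r\<^sup>2) * (cmod m)\<^sup>2 / (1 + r\<^sup>2)\<^sup>2"
    unfolding p_def norm_mult norm_divide power_mult_distrib power_divide norm_of_real power2_abs
    by (simp add: cmod_power2)
  then have p1: "(cmod p)\<^sup>2 = 1" using * r by (simp add: power2_eq_square)
  have "p * cnj m = (1 + \<i> * of_real r) * of_real ((cmod m)\<^sup>2) / of_real (1 + r\<^sup>2)"
    unfolding p_def complex_norm_square by simp
  then have "p * cnj m = 1 + \<i> * of_real r" using * r
    by (metis nonzero_mult_div_cancel_right of_real_eq_0_iff)
  then have "Re (p * cnj m) = 1" by simp
  then have "p \<in> hermitian_line 1 m" using p1 by (simp add: hermitian_line_def)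
  moreover have "p \<in> sphere 0 1" using p1 by (simp add: power2_eq_1_iff) (smt (verit) norm_ge_zero)
  moreover have "orthogonal (q - m) q" if "q \<in> hermitian_line 1 m" "q \<in> sphere 0 1" for q
  proof -
    have "(cmod q)\<^sup>2 = 1" using that by simp
    then show ?thesis using that(1)
      unfolding hermitian_line_def orthogonal_def inner_complex_def cmod_power2
      by (simp add: power2_eq_square algebra_simps)
  qed
  ultimately show "perp_unit_circle m r"
    unfolding perp_unit_circle_def using * sphere_eq_hermitian_line[of m r] by auto
qed

text \<open>For nonzero \<open>\<alpha>\<close> the centre is \<open>m / \<alpha>\<close>, and the
  inequality puts it outside the closed disk, so that an orthogonal circle around it exists. For
  \<open>\<alpha> = 0\<close> the set is the diameter with normal \<open>m\<close>. Both kinds of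
  geodesic thus become one case.\<close>

lemma hyp_line_iff:
  "hyp_line l \<longleftrightarrow> (\<exists>\<alpha> m. \<bar>\<alpha>\<bar> < cmod m \<and> l = hermitian_line \<alpha> m \<inter> ball 0 1)"
proof
  assume "hyp_line l"
  then consider c r where "0 < r" "(cmod c)\<^sup>2 = 1 + r\<^sup>2" "l = sphere c r \<inter> ball 0 1"
    | u where "u \<noteq> 0" "l = span {u} \<inter> ball 0 1"
    unfolding hyp_line_def perp_unit_circle_iff by blast
  then show "\<exists>\<alpha> m. \<bar>\<alpha>\<bar> < cmod m \<and> l = hermitian_line \<alpha> m \<inter> ball 0 1"
  proof cases
    case 1
    have "1\<^sup>2 < (cmod c)\<^sup>2" using 1 by simp
    then have "1 < cmod c" by (rule power2_less_imp_less) simp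
    with 1 sphere_eq_hermitian_line[of c r] show ?thesis by (intro exI[of _ 1] exI[of _ c]) simp
  next
    case 2
    with span_eq_hermitian_line[of u] show ?thesis
      by (intro exI[of _ 0] exI[of _ "\<i> * u"]) (simp add: norm_mult)
  qed
next
  assume "\<exists>\<alpha> m. \<bar>\<alpha>\<bar> < cmod m \<and> l = hermitian_line \<alpha> m \<inter> ball 0 1"
  then obtain \<alpha> m where *: "\<bar>\<alpha>\<bar> < cmod m" and l: "l = hermitian_line \<alpha> m \<inter> ball 0 1" by blast
  show "hyp_line l"
  proof (cases "\<alpha> = 0")
    case True
    then have "l = span {- \<i> * m} \<inter> ball 0 1"
      using * l span_eq_hermitian_line[of "- \<i> * m"] by auto
    moreover have "- \<i> * m \<noteq> 0" using * True by simp
    ultimately show ?thesis unfolding hyp_line_def by blast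
  next
    case False
    define c where "c = m / of_real \<alpha>"
    define r where "r = sqrt ((cmod c)\<^sup>2 - 1)"
    have "1 < cmod c" using * False by (simp add: c_def norm_divide)
    then have "1 < (cmod c)\<^sup>2" by (simp add: one_less_power)
    then have r: "0 < r" "(cmod c)\<^sup>2 = 1 + r\<^sup>2" by (auto simp: r_def)
    have "hermitian_line \<alpha> m = hermitian_line 1 c"
      using False by (auto simp: hermitian_line_def c_def field_simps)
    then have "l = sphere c r \<inter> ball 0 1"
      using l sphere_eq_hermitian_line[OF r(2,1)] by simp
    then show ?thesis unfolding hyp_line_def perp_unit_circle_iff using r by blast
  qed
qed

text \<open>Substituting the transformation and clearing its denominator gives a form of the same
  shape. Its discriminant \<open>|m|^2 - \<alpha>^2\<close> is multiplied by the positive number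
  \<open>(1 - |a|^2)^2\<close>, so it stays positive.\<close>

lemma Moebius_mem_hermitian_line:
  assumes "cmod a < 1" "\<bar>\<alpha>\<bar> < cmod m"
  obtains \<alpha>' m' where "\<bar>\<alpha>'\<bar> < cmod m'"
    "\<And>w. cmod w \<le> 1 \<Longrightarrow> Moebius_function t a w \<in> hermitian_line \<alpha> m \<longleftrightarrow> w \<in> hermitian_line \<alpha>' m'"
proof -
  \<comment> \<open>The rotation is absorbed into \<open>n\<close>; \<open>\<alpha>'\<close> and
    \<open>m'\<close> are the coefficients read off after multiplication by
    \<open>|1 - cnj a * w|^2\<close>.\<close>
  define n where "n = cnj (exp (\<i> * of_real t)) * m"
  define \<alpha>' where "\<alpha>' = \<alpha> * (1 + (cmod a)\<^sup>2) + 2 * Re (cnj n * a)"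
  define m' where "m' = n + cnj n * a\<^sup>2 + of_real (2 * \<alpha>) * a"
  have n: "cmod n = cmod m" by (simp add: n_def norm_mult)
  have "(cmod m')\<^sup>2 - \<alpha>'\<^sup>2 = (1 - (cmod a)\<^sup>2)\<^sup>2 * ((cmod n)\<^sup>2 - \<alpha>\<^sup>2)"
    unfolding cmod_power2 \<alpha>'_def m'_def by (simp add: power2_eq_square) algebra
  moreover have "\<alpha>\<^sup>2 < (cmod n)\<^sup>2"
    using assms(2) n by (metis abs_ge_zero power2_abs power_strict_mono zero_less_numeral)
  moreover have "0 < (1 - (cmod a)\<^sup>2)\<^sup>2"
    using assms(1) by (simp add: abs_square_eq_1)
  ultimately have "\<alpha>'\<^sup>2 < (cmod m')\<^sup>2"
    by (metis diff_gt_0_iff_gt mult_pos_pos)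
  then have "\<bar>\<alpha>'\<bar> < cmod m'"
    by (metis norm_ge_zero power2_abs power2_less_imp_less)
  moreover have "Moebius_function t a w \<in> hermitian_line \<alpha> m \<longleftrightarrow> w \<in> hermitian_line \<alpha>' m'"
    if "cmod w \<le> 1" for w
  proof -
    define q where "q = 1 - cnj a * w"
    have q: "q \<noteq> 0" unfolding q_def by (rule Moebius_denom_nonzero[OF assms(1) that])
    have "(cmod (Moebius_function t a w))\<^sup>2 + 1 = ((cmod (w - a))\<^sup>2 + (cmod q)\<^sup>2) / (cmod q)\<^sup>2"
      using q by (simp add: norm_Moebius power_divide add_divide_distrib flip: q_def)
    moreover have "Moebius_function t a w * cnj m = (w - a) * cnj q * cnj n / of_real ((cmod q)\<^sup>2)"
      using q unfolding complex_norm_square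
      by (simp add: Moebius_function_def n_def mult.assoc mult.left_commute flip: q_def)
    then have "Re (Moebius_function t a w * cnj m) = Re ((w - a) * cnj q * cnj n) / (cmod q)\<^sup>2"
      by (metis Re_divide_of_real)
    moreover have "(cmod q)\<^sup>2 \<noteq> 0" using q by simp
    ultimately have "Moebius_function t a w \<in> hermitian_line \<alpha> m \<longleftrightarrow>
        \<alpha> * ((cmod (w - a))\<^sup>2 + (cmod q)\<^sup>2) = 2 * Re ((w - a) * cnj q * cnj n)"
      by (simp only: hermitian_line_def mem_Collect_eq times_divide_eq_right divide_cancel_right simp_thms)
    also have "\<alpha> * ((cmod (w - a))\<^sup>2 + (cmod q)\<^sup>2) - 2 * Re ((w - a) * cnj q * cnj n) =
        \<alpha>' * ((cmod w)\<^sup>2 + 1) - 2 * Re (w * cnj m')"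
      unfolding cmod_power2 \<alpha>'_def m'_def q_def
      by (simp add: power2_eq_square) algebra
    then have "(\<alpha> * ((cmod (w - a))\<^sup>2 + (cmod q)\<^sup>2) = 2 * Re ((w - a) * cnj q * cnj n)) \<longleftrightarrow>
        \<alpha>' * ((cmod w)\<^sup>2 + 1) = 2 * Re (w * cnj m')" by linarith
    finally show ?thesis by (simp add: hermitian_line_def)
  qed
  ultimately show ?thesis using that by blast
qed

text \<open>The preceding lemma describes preimages. An image is the preimage under the inverse
  transformation.\<close>

lemma hyp_line_Moebius:
  assumes "cmod a < 1" "hyp_line l"
  shows "hyp_line (Moebius_function t a ` l)"
proof -
  define b where "b = - (exp (\<i> * of_real t) * a)"
  have b: "cmod b < 1" using assms by (simp add: b_def norm_mult)
  obtain \<alpha> m where *: "\<bar>\<alpha>\<bar> < cmod m" and l: "l = hermitian_line \<alpha> m \<inter> ball 0 1"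
    using assms(2) unfolding hyp_line_iff by blast
  obtain \<alpha>' m' where **: "\<bar>\<alpha>'\<bar> < cmod m'" and
    eq: "\<And>w. cmod w \<le> 1 \<Longrightarrow> Moebius_function (- t) b w \<in> hermitian_line \<alpha> m \<longleftrightarrow> w \<in> hermitian_line \<alpha>' m'"
    using Moebius_mem_hermitian_line[OF b *] by blast
  have "Moebius_function t a ` l = hermitian_line \<alpha>' m' \<inter> ball 0 1"
  proof (intro equalityI subsetI)
    fix w assume "w \<in> Moebius_function t a ` l"
    then obtain z where z: "z \<in> hermitian_line \<alpha> m" "cmod z < 1" "w = Moebius_function t a z"
      using l by auto
    moreover have "Moebius_function (- t) b w = z" "cmod w < 1"
      using z assms Moebius_inverse[of a z t] Moebius_norm_less_iff[of a z t] by (auto simp: b_def)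
    ultimately show "w \<in> hermitian_line \<alpha>' m' \<inter> ball 0 1" using eq[of w] by simp
  next
    fix w assume "w \<in> hermitian_line \<alpha>' m' \<inter> ball 0 1"
    then have w: "w \<in> hermitian_line \<alpha>' m'" "cmod w < 1" by auto
    then have "Moebius_function (- t) b w \<in> l"
      using eq[of w] Moebius_norm_less_iff[OF b, of w] l by simp
    moreover have "w = Moebius_function t a (Moebius_function (- t) b w)"
      using Moebius_inverse_right[of a w t] w assms by (simp add: b_def)
    ultimately show "w \<in> Moebius_function t a ` l" by blast
  qed
  with ** show ?thesis unfolding hyp_line_iff by blast
qed

section \<open>Closures of geodesics, and geodesic segments\<close>

lemma closure_hyp_line_subset: "hyp_line l \<Longrightarrow> closure l \<subseteq> cball 0 1"
  by (rule closure_minimal) (auto simp: hyp_line_iff)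

lemma closure_Moebius_image:
  assumes "cmod a < 1" "hyp_line l"
  shows "closure (Moebius_function t a ` l) = Moebius_function t a ` closure l"
proof
  have l: "closure l \<subseteq> cball 0 1" by (rule closure_hyp_line_subset[OF assms(2)])
  have c: "continuous_on (closure l) (Moebius_function t a)"
    using continuous_on_subset[OF continuous_on_Moebius[OF assms(1)] l] .
  show "Moebius_function t a ` closure l \<subseteq> closure (Moebius_function t a ` l)"
    by (rule image_closure_subset[OF c]) (auto simp: closure_subset)
  have "compact (closure l)"
    using l compact_cball by (metis bounded_cball bounded_subset closed_closure compact_eq_bounded_closed)
  then have "closed (Moebius_function t a ` closure l)"
    by (intro compact_imp_closed compact_continuous_image c)
  then show "closure (Moebius_function t a ` l) \<subseteq> Moebius_function t a ` closure l"
    by (intro closure_minimal) (use closure_subset in auto)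
qed

text \<open>A segment is an intersection of connected sets \<open>K\<close>. Every \<open>K\<close>
  competing for the image points is pulled back by the inverse to one competing for \<open>x\<close>
  and \<open>y\<close>.\<close>

lemma Moebius_hyp_seg_subset:
  assumes "cmod a < 1" "cmod x \<le> 1" "cmod y \<le> 1"
  shows "Moebius_function t a ` hyp_seg x y \<subseteq> hyp_seg (Moebius_function t a x) (Moebius_function t a y)"
proof
  define b where "b = - (exp (\<i> * of_real t) * a)"
  let ?T = "Moebius_function t a" and ?S = "Moebius_function (- t) b"
  have b: "cmod b < 1" using assms by (simp add: b_def norm_mult)
  fix w assume "w \<in> ?T ` hyp_seg x y"
  then obtain z where z: "z \<in> hyp_seg x y" "w = ?T z" by blast
  then have z1: "cmod z < 1" by (simp add: hyp_seg_def)
  have "w \<in> K" if K: "hyp_line l" "K \<subseteq> closure l" "connected K" "?T x \<in> K" "?T y \<in> K" for l K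
  proof -
    have K1: "K \<subseteq> cball 0 1" using closure_hyp_line_subset[OF K(1)] K(2) by blast
    have "hyp_line (?S ` l)" by (rule hyp_line_Moebius[OF b K(1)])
    moreover have "?S ` K \<subseteq> closure (?S ` l)"
      using closure_Moebius_image[OF b K(1)] K(2) by blast
    moreover have "connected (?S ` K)"
      by (intro connected_continuous_image K continuous_on_subset[OF continuous_on_Moebius[OF b] K1])
    moreover have "x \<in> ?S ` K" "y \<in> ?S ` K"
      using K(4,5) Moebius_inverse[OF assms(1,2), of t] Moebius_inverse[OF assms(1,3), of t]
      unfolding b_def by (metis imageI)+
    ultimately have "z \<in> ?S ` K" using z(1) unfolding hyp_seg_def by blast
    then obtain k where k: "k \<in> K" "z = ?S k" by blast
    moreover have "?T (?S k) = k"
      using Moebius_inverse_right[OF assms(1), of k t] K1 k by (auto simp: b_def)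
    ultimately show "w \<in> K" using z by simp
  qed
  moreover have "w \<in> ball 0 1" using z z1 Moebius_norm_less_iff[OF assms(1), of z t] by simp
  ultimately show "w \<in> hyp_seg (?T x) (?T y)" unfolding hyp_seg_def by blast
qed

lemma hyp_seg_Moebius:
  assumes "cmod a < 1" "cmod x \<le> 1" "cmod y \<le> 1"
  shows "hyp_seg (Moebius_function t a x) (Moebius_function t a y) = Moebius_function t a ` hyp_seg x y"
proof
  define b where "b = - (exp (\<i> * of_real t) * a)"
  let ?T = "Moebius_function t a" and ?S = "Moebius_function (- t) b"
  have b: "cmod b < 1" using assms by (simp add: b_def norm_mult)
  have "?S ` hyp_seg (?T x) (?T y) \<subseteq> hyp_seg (?S (?T x)) (?S (?T y))"
    by (intro Moebius_hyp_seg_subset b Moebius_norm_less_iff assms)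
  also have "\<dots> = hyp_seg x y" using assms by (simp add: b_def Moebius_inverse)
  finally have "?T ` ?S ` hyp_seg (?T x) (?T y) \<subseteq> ?T ` hyp_seg x y" by blast
  moreover have "?T (?S z) = z" if "z \<in> hyp_seg (?T x) (?T y)" for z
    using that Moebius_inverse_right[OF assms(1), of z t] by (auto simp: b_def hyp_seg_def)
  ultimately show "hyp_seg (?T x) (?T y) \<subseteq> ?T ` hyp_seg x y" by force
qed (use Moebius_hyp_seg_subset[OF assms] in blast)

text \<open>The Euclidean segment is itself an admissible \<open>K\<close>. Conversely, a geodesic
  whose closure contains 0 has \<open>\<alpha> = 0\<close>, so it is the diameter through
  \<open>b\<close>, and a connected part of it containing 0 and \<open>b\<close> contains everything
  between them.\<close>

lemma hyp_seg_zero: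
  assumes "b \<noteq> 0" "cmod b \<le> 1"
  shows "hyp_seg 0 b = closed_segment 0 b \<inter> ball 0 1"
proof (intro equalityI subsetI)
  fix z assume z: "z \<in> hyp_seg 0 b"
  define l where "l = span {b} \<inter> ball 0 1"
  have "hyp_line l" using assms unfolding l_def hyp_line_def by blast
  \<comment> \<open>If \<open>b\<close> is ideal it is not in \<open>l\<close>; the closed segment
    is reached as the closure of the open one.\<close>
  moreover have "open_segment 0 b \<subseteq> l"
  proof
    fix w assume "w \<in> open_segment 0 b"
    then obtain s where s: "0 < s" "s < 1" "w = s *\<^sub>R b" by (auto simp: in_segment)
    have "cmod w = s * cmod b" using s by simp
    also have "\<dots> \<le> s * 1" using s assms by (intro mult_left_mono) auto
    finally have "cmod w < 1" using s(2) by linarith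
    then show "w \<in> l" using s(3) by (auto simp: l_def span_singleton)
  qed
  then have "closed_segment 0 b \<subseteq> closure l"
    using closure_mono[of "open_segment 0 b" l] assms(1) by simp
  ultimately have "z \<in> closed_segment 0 b" using z unfolding hyp_seg_def by force
  moreover have "z \<in> ball 0 1" using z by (simp add: hyp_seg_def)
  ultimately show "z \<in> closed_segment 0 b \<inter> ball 0 1" by blast
next
  fix z assume z: "z \<in> closed_segment 0 b \<inter> ball 0 1"
  then obtain s where s: "0 \<le> s" "s \<le> 1" "z = s *\<^sub>R b" by (auto simp: in_segment)
  have "z \<in> K" if K: "hyp_line l" "K \<subseteq> closure l" "connected K" "0 \<in> K" "b \<in> K" for l K
  proof -
    obtain \<alpha> m where m: "\<bar>\<alpha>\<bar> < cmod m" and "l = hermitian_line \<alpha> m \<inter> ball 0 1"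
      using K(1) unfolding hyp_line_iff by blast
    then have "closure l \<subseteq> hermitian_line \<alpha> m"
      by (intro closure_minimal closed_hermitian_line) auto
    with K(2) have K': "K \<subseteq> hermitian_line \<alpha> m" by blast
    then have "\<alpha> = 0" using K(4) by (auto simp: hermitian_line_def)
    with m K' span_eq_hermitian_line[of "- \<i> * m"] have Ks: "K \<subseteq> span {- \<i> * m}" by simp
    then have "b \<in> span {- \<i> * m}" using K(5) by blast
    then obtain k where k: "b = k *\<^sub>R (- \<i> * m)" by (auto simp: span_singleton)
    with assms(1) have "k \<noteq> 0" by auto
    with k have "- \<i> * m = (1 / k) *\<^sub>R b" by simp
    have Kb: "\<exists>r. w = r *\<^sub>R b" if "w \<in> K" for w
    proof -
      obtain c where "w = c *\<^sub>R (- \<i> * m)" using \<open>w \<in> K\<close> Ks unfolding span_singleton by blast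
      then show ?thesis unfolding \<open>- \<i> * m = (1 / k) *\<^sub>R b\<close> by (metis scaleR_scaleR)
    qed
    \<comment> \<open>The inner product with \<open>b\<close> is a linear coordinate on the
      diameter, so the intermediate value property applies to its image.\<close>
    let ?f = "\<lambda>w. w \<bullet> b"
    have "connected (?f ` K)"
      by (intro connected_continuous_image continuous_intros K)
    moreover have "0 \<in> ?f ` K" "b \<bullet> b \<in> ?f ` K" using K(4,5) by (auto intro: rev_image_eqI)
    moreover have "0 \<le> s * (b \<bullet> b)" "s * (b \<bullet> b) \<le> b \<bullet> b"
      using s by (auto intro: mult_left_le_one_le)
    ultimately have "s * (b \<bullet> b) \<in> ?f ` K"
      by (meson connected_contains_Icc atLeastAtMost_iff subsetD)
    then obtain w where w: "w \<in> K" "w \<bullet> b = s * (b \<bullet> b)" by force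
    obtain r where r: "w = r *\<^sub>R b" using Kb[OF w(1)] by blast
    have "r = s" using w(2) r assms(1) by simp
    with r s w(1) show "z \<in> K" by simp
  qed
  with z show "z \<in> hyp_seg 0 b" unfolding hyp_seg_def by blast
qed

section \<open>Invariance of distances, directions and angles\<close>

lemma norm_Moebius_denom:
  "(cmod (1 - cnj x * y))\<^sup>2 = (cmod (x - y))\<^sup>2 + (1 - (cmod x)\<^sup>2) * (1 - (cmod y)\<^sup>2)"
  unfolding cmod_power2 by (simp add: power2_eq_square algebra_simps)

lemma hyp_dist_eq: "hyp_dist x y = 2 * artanh (cmod (Moebius_function 0 x y))"
  by (simp add: hyp_dist_def norm_Moebius norm_minus_commute flip: norm_Moebius_denom)

text \<open>Two disk automorphisms sending \<open>x\<close> to 0 differ by a rotation; here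
  \<open>u\<close> is computed explicitly. It does not depend on \<open>y\<close>, so distances from
  \<open>x\<close> and angles at \<open>x\<close> are both invariant.\<close>

lemma Moebius_Moebius:
  assumes "cmod a < 1" "cmod x < 1"
  obtains u where "cmod u = 1"
    "\<And>y. cmod y \<le> 1 \<Longrightarrow>
       Moebius_function 0 (Moebius_function t a x) (Moebius_function t a y) = u * Moebius_function 0 x y"
proof -
  define e where "e = exp (\<i> * of_real t)"
  define u where "u = e * (1 - a * cnj x) / (1 - cnj a * x)"
  have e: "e * cnj e = 1" unfolding e_def by (simp add: exp_cnj exp_minus flip: exp_add)
  have ax: "1 - cnj a * x \<noteq> 0" by (rule Moebius_denom_nonzero) (use assms in auto)
  have aa: "1 - cnj a * a \<noteq> 0" by (rule Moebius_denom_nonzero) (use assms in auto)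
  have cax: "1 - a * cnj x \<noteq> 0" using ax
    by (metis complex_cnj_cnj complex_cnj_diff complex_cnj_mult complex_cnj_one complex_cnj_zero_iff)
  have "cmod (1 - a * cnj x) = cmod (1 - cnj a * x)"
    by (metis complex_cnj_cnj complex_cnj_diff complex_cnj_mult complex_cnj_one complex_mod_cnj)
  then have "cmod u = 1" using ax by (simp add: u_def norm_mult norm_divide e_def)
  moreover have "Moebius_function 0 (Moebius_function t a x) (Moebius_function t a y) = u * Moebius_function 0 x y"
    if y: "cmod y \<le> 1" for y
  proof -
    have ay: "1 - cnj a * y \<noteq> 0" by (rule Moebius_denom_nonzero[OF assms(1) y])
    have xy: "1 - cnj x * y \<noteq> 0" by (rule Moebius_denom_nonzero[OF assms(2) y])
    let ?X = "e * (x - a) / (1 - cnj a * x)" and ?Y = "e * (y - a) / (1 - cnj a * y)"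
    have 1: "?Y - ?X = e * (1 - cnj a * a) * (y - x) / ((1 - cnj a * x) * (1 - cnj a * y))"
      using ax ay by (simp add: divide_simps) algebra
    have 2: "1 - cnj ?X * ?Y = (1 - cnj a * a) * (1 - cnj x * y) / ((1 - a * cnj x) * (1 - cnj a * y))"
      using cax ay e by (simp add: divide_simps) algebra
    have "Moebius_function 0 (Moebius_function t a x) (Moebius_function t a y) = (?Y - ?X) / (1 - cnj ?X * ?Y)"
      by (simp add: Moebius_function_def flip: e_def)
    also have "\<dots> = u * ((y - x) / (1 - cnj x * y))"
      unfolding 1 2 u_def using ax ay aa xy cax by (simp add: divide_simps)
    finally show ?thesis by (simp add: Moebius_function_simple)
  qed
  ultimately show ?thesis using that by blast
qed

lemma hyp_dist_Moebius:
  assumes "cmod a < 1" "cmod x < 1" "cmod y \<le> 1"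
  shows "hyp_dist (Moebius_function t a x) (Moebius_function t a y) = hyp_dist x y"
proof -
  obtain u where "cmod u = 1"
    "\<And>y. cmod y \<le> 1 \<Longrightarrow>
       Moebius_function 0 (Moebius_function t a x) (Moebius_function t a y) = u * Moebius_function 0 x y"
    using Moebius_Moebius[OF assms(1,2)] by blast
  then show ?thesis using assms(3) by (simp add: hyp_dist_eq norm_mult)
qed

section \<open>Directions and angles at points of the disk\<close>

lemma hyp_seg_eq_Moebius:
  assumes "cmod x < 1" "cmod y \<le> 1" "y \<noteq> x"
  shows "Moebius_function 0 x y \<noteq> 0"
    "hyp_seg x y = Moebius_function 0 (- x) ` (closed_segment 0 (Moebius_function 0 x y) \<inter> ball 0 1)"
proof -
  show w: "Moebius_function 0 x y \<noteq> 0"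
    using Moebius_denom_nonzero[OF assms(1,2)] assms(3) by (simp add: Moebius_function_simple)
  have "hyp_seg 0 (Moebius_function 0 x y) = closed_segment 0 (Moebius_function 0 x y) \<inter> ball 0 1"
    by (intro hyp_seg_zero w Moebius_norm_less_iff assms)
  moreover have "hyp_seg (Moebius_function 0 (- x) 0) (Moebius_function 0 (- x) (Moebius_function 0 x y)) =
      Moebius_function 0 (- x) ` hyp_seg 0 (Moebius_function 0 x y)"
    by (intro hyp_seg_Moebius) (use assms Moebius_norm_less_iff in auto)
  moreover have "Moebius_function 0 (- x) 0 = x" by (simp add: Moebius_function_of_zero)
  moreover have "Moebius_function 0 (- x) (Moebius_function 0 x y) = y"
    using Moebius_inverse[OF assms(1,2), of 0] by simp
  ultimately show "hyp_seg x y = Moebius_function 0 (- x) ` (closed_segment 0 (Moebius_function 0 x y) \<inter> ball 0 1)"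
    by simp
qed

text \<open>Moving \<open>x\<close> to 0 straightens the geodesic to a radius. The derivative of
  this map at \<open>x\<close> is positive, so the tangent direction is unchanged.\<close>

lemma hyp_dir_eq:
  assumes "cmod x < 1" "cmod y \<le> 1" "y \<noteq> x"
  shows "hyp_dir x y = sgn (Moebius_function 0 x y)"
proof -
  define w where "w = Moebius_function 0 x y"
  have w: "w \<noteq> 0" "cmod w \<le> 1"
    using hyp_seg_eq_Moebius(1)[OF assms] Moebius_norm_less_iff[OF assms(1,2)] by (auto simp: w_def)
  define A where "A = closed_segment 0 w \<inter> ball 0 1"
  define S where "S = Moebius_function 0 (- x)"
  have seg: "hyp_seg x y = S ` A"
    unfolding S_def A_def w_def by (rule hyp_seg_eq_Moebius(2)[OF assms])
  have inv: "Moebius_function 0 x (S z) = z" if "cmod z \<le> 1" for z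
    using Moebius_inverse_right[OF assms(1) that, of 0] by (simp add: S_def)
  have A1: "A \<subseteq> cball 0 1" by (auto simp: A_def)
  \<comment> \<open>\<open>Lim\<close> is determined only along a nontrivial filter. The segment is
    connected and has more than one point, so \<open>x\<close> is a limit point of it.\<close>
  have "continuous_on A S" unfolding S_def
    by (rule continuous_on_subset[OF continuous_on_Moebius A1]) (use assms in simp)
  moreover have "connected A" unfolding A_def
    by (intro convex_connected convex_Int) auto
  ultimately have "connected (S ` A)" by (intro connected_continuous_image)
  moreover have "x \<in> S ` A"
    by (rule image_eqI[of _ _ 0]) (auto simp: S_def A_def Moebius_function_of_zero)
  moreover have x_only: "S ` A \<noteq> {x}"
  proof
    assume "S ` A = {x}"
    moreover have "w / 2 \<in> A"
      using w by (auto simp: A_def in_segment norm_divide scaleR_conv_of_real intro!: exI[of _ "1/2"])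
    ultimately have "S (w / 2) = x" by blast
    moreover have "Moebius_function 0 x x = 0" by (rule Moebius_function_eq_zero)
    ultimately have "w / 2 = 0" using inv[of "w / 2"] w by simp
    then show False using w by simp
  qed
  ultimately have lim: "x islimpt S ` A"
    by (intro connected_imp_perfect) (metis x_only singletonD)+
  \<comment> \<open>Along the segment \<open>z - x\<close> is a positive multiple of
    \<open>w\<close> times \<open>1 - cnj x * z\<close>, and this last factor tends to the positive
    number \<open>1 - |x|^2\<close>.\<close>
  have sgn_eq: "sgn (z - x) = sgn w * sgn (1 - cnj x * z)" if z: "z \<in> S ` A" "z \<noteq> x" for z
  proof -
    obtain v where v: "v \<in> A" "z = S v" using z by blast
    obtain s where s: "0 \<le> s" "v = s *\<^sub>R w" using v(1) by (auto simp: A_def in_segment)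
    have "cmod v \<le> 1" using v A1 by auto
    then have z1: "Moebius_function 0 x z = v" "cmod z \<le> 1"
      using inv v Moebius_norm_less_iff[of "-x" v 0] assms(1) by (auto simp: S_def)
    have "1 - cnj x * z \<noteq> 0" by (rule Moebius_denom_nonzero[OF assms(1) z1(2)])
    then have "z - x = v * (1 - cnj x * z)" using z1(1) by (simp add: Moebius_function_simple field_simps)
    then have eq: "z - x = s *\<^sub>R w * (1 - cnj x * z)" using s by simp
    moreover have "s \<noteq> 0" using eq z(2) by auto
    ultimately show ?thesis using s(1) by (simp add: sgn_mult scaleR_conv_of_real sgn_of_real)
  qed
  have "(cmod x)\<^sup>2 < 1" using assms(1) by (simp add: abs_square_less_1)
  then have pos: "1 - cnj x * x = of_real (1 - (cmod x)\<^sup>2)" "0 < 1 - (cmod x)\<^sup>2"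
    using complex_norm_square[of x] by (simp_all add: mult.commute)
  have sx: "sgn (1 - cnj x * x) = 1" unfolding pos(1) sgn_of_real using pos(2) by simp
  have "((\<lambda>z. sgn w * sgn (1 - cnj x * z)) \<longlongrightarrow> sgn w * sgn (1 - cnj x * x)) (at x within S ` A)"
    by (intro tendsto_intros) (use Moebius_denom_nonzero[of x x] assms(1) in auto)
  then have "((\<lambda>z. sgn (z - x)) \<longlongrightarrow> sgn w) (at x within S ` A)"
    unfolding sx mult_1_right by (rule Lim_transform_eventually) (auto simp: eventually_at_filter sgn_eq)
  moreover have "\<not> trivial_limit (at x within S ` A)" using lim by (simp add: trivial_limit_within)
  ultimately show ?thesis unfolding hyp_dir_def seg w_def[symmetric] by (intro tendsto_Lim)
qed

lemma hyp_dir_Moebius: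
  assumes "cmod a < 1" "cmod x < 1"
  obtains u where "cmod u = 1"
    "\<And>y. cmod y \<le> 1 \<Longrightarrow> y \<noteq> x \<Longrightarrow> hyp_dir (Moebius_function t a x) (Moebius_function t a y) = u * hyp_dir x y"
proof -
  obtain u where u: "cmod u = 1"
    "\<And>y. cmod y \<le> 1 \<Longrightarrow>
       Moebius_function 0 (Moebius_function t a x) (Moebius_function t a y) = u * Moebius_function 0 x y"
    using Moebius_Moebius[OF assms] by blast
  have "hyp_dir (Moebius_function t a x) (Moebius_function t a y) = u * hyp_dir x y"
    if y: "cmod y \<le> 1" "y \<noteq> x" for y
  proof -
    have "Moebius_function t a y \<noteq> Moebius_function t a x"
      using y assms Moebius_inverse[of a x t] Moebius_inverse[of a y t] by force
    then have "hyp_dir (Moebius_function t a x) (Moebius_function t a y) = sgn (u * Moebius_function 0 x y)"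
      using hyp_dir_eq[of "Moebius_function t a x" "Moebius_function t a y"] u(2)[OF y(1)]
        Moebius_norm_less_iff[OF assms(1)] assms(2) y(1) by simp
    also have "\<dots> = u * sgn (Moebius_function 0 x y)"
      using u(1) by (simp add: sgn_div_norm norm_mult scaleR_conv_of_real)
    finally show ?thesis using hyp_dir_eq[OF assms(2) y] by simp
  qed
  with u(1) that show ?thesis by blast
qed

lemma interior_angle_Moebius:
  assumes "cmod a < 1" "cmod v < 1" "cmod p \<le> 1" "cmod n \<le> 1" "p \<noteq> v" "n \<noteq> v"
  shows "interior_angle (Moebius_function t a p) (Moebius_function t a v) (Moebius_function t a n) =
    interior_angle p v n"
proof -
  obtain u where "cmod u = 1"
    "\<And>y. cmod y \<le> 1 \<Longrightarrow> y \<noteq> v \<Longrightarrow> hyp_dir (Moebius_function t a v) (Moebius_function t a y) = u * hyp_dir v y"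
    using hyp_dir_Moebius[OF assms(1,2)] by blast
  moreover from this have "u \<noteq> 0" by auto
  ultimately show ?thesis using assms unfolding interior_angle_def by simp
qed

section \<open>Inverse hyperbolic tangent\<close>

lemma artanh_real_mono:
  fixes x y :: real
  assumes "- 1 < x" "x \<le> y" "y < 1"
  shows "artanh x \<le> artanh y"
proof -
  have "(1 + x) / (1 - x) \<le> (1 + y) / (1 - y)"
    using assms by (intro frac_le) auto
  moreover have "0 < (1 + x) / (1 - x)" using assms by simp
  ultimately show ?thesis by (simp add: artanh_def)
qed

text \<open>The argument \<open>(1 + x) / (1 - x)\<close> of the logarithm gets squared. This
  converts a radius in the disk into its Klein radius and absorbs the factor 2 of
  \<open>hyp_dist\<close>.\<close>

lemma artanh_double:
  fixes x :: real
  assumes "\<bar>x\<bar> < 1"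
  shows "2 * artanh x = artanh (2 * x / (1 + x\<^sup>2))"
proof -
  have p: "1 + x\<^sup>2 \<noteq> 0" by (simp add: add_nonneg_eq_0_iff)
  have "1 + 2 * x / (1 + x\<^sup>2) = (1 + x)\<^sup>2 / (1 + x\<^sup>2)" "1 - 2 * x / (1 + x\<^sup>2) = (1 - x)\<^sup>2 / (1 + x\<^sup>2)"
    using p by (simp_all add: field_simps power2_eq_square)
  then have "(1 + 2 * x / (1 + x\<^sup>2)) / (1 - 2 * x / (1 + x\<^sup>2)) = ((1 + x) / (1 - x))\<^sup>2"
    using p by (simp add: power_divide)
  moreover have "0 < (1 + x) / (1 - x)" using assms by auto
  ultimately show ?thesis by (simp add: artanh_def ln_realpow)
qed

lemma tanh_artanh_real:
  fixes x :: real
  assumes "\<bar>x\<bar> < 1"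
  shows "tanh (artanh x) = x"
proof -
  have "0 < (1 + x) / (1 - x)" using assms by auto
  then have eq: "exp (- 2 * artanh x) = (1 - x) / (1 + x)"
    by (simp add: artanh_def exp_minus)
  show ?thesis unfolding tanh_real_altdef eq using assms by (simp add: divide_simps)
qed

text \<open>That is, \<open>artanh x / x\<close> increases strictly. With
  \<open>l = p / q < 1\<close> the function \<open>l * artanh x - artanh (l * x)\<close> vanishes at
  0 and has positive derivative \<open>l / (1 - x^2) - l / (1 - (l * x)^2)\<close>.\<close>

lemma artanh_ratio_less:
  fixes p q :: real
  assumes "0 < p" "p < q" "q < 1"
  shows "q * artanh p < p * artanh q"
proof -
  define l where "l = p / q"
  have l: "0 < l" "l < 1" "l * q = p" using assms by (auto simp: l_def)
  have lx: "0 < l * x" "l * x < x" if "0 < x" for x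
    using l that by auto
  define k where "k = (\<lambda>x. l * artanh x - artanh (l * x))"
  have "k 0 < k q"
  proof (rule DERIV_pos_imp_increasing_open[where f = k])
    show "0 < q" using assms by simp
  next
    fix x assume x: "0 < x" "x < q"
    have "(l * x)\<^sup>2 < x\<^sup>2" using lx[of x] x by (intro power_strict_mono) auto
    moreover have "x\<^sup>2 < 1" using x assms by (simp add: abs_square_less_1)
    ultimately have less: "l * (1 / (1 - (l * x)\<^sup>2)) < l * (1 / (1 - x\<^sup>2))"
      using l by (intro mult_strict_left_mono divide_strict_left_mono) auto
    have lx1: "\<bar>l * x\<bar> < 1" using lx[OF x(1)] x assms by linarith
    have "((\<lambda>x. artanh (l * x)) has_real_derivative 1 / (1 - (l * x)\<^sup>2) * l) (at x)"
      by (rule DERIV_chain2[where f = artanh and g = "\<lambda>x. l * x"])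
         (use lx1 in \<open>auto intro!: artanh_real_has_field_derivative DERIV_cmult_Id\<close>)
    then have "(k has_real_derivative l * (1 / (1 - x\<^sup>2)) - 1 / (1 - (l * x)\<^sup>2) * l) (at x)"
      unfolding k_def
      by (intro DERIV_diff DERIV_cmult artanh_real_has_field_derivative) (use x assms in auto)
    then show "\<exists>y. (k has_real_derivative y) (at x) \<and> 0 < y"
      using less by (metis diff_gt_0_iff_gt mult.commute)
  next
    have "l * x < 1 \<and> - 1 < l * x" if "0 \<le> x" "x \<le> q" for x
    proof (cases "x = 0")
      case False
      then show ?thesis using lx[of x] that assms by linarith
    qed simp
    then show "continuous_on {0..q} k"
      unfolding k_def using assms by (intro continuous_intros) (auto simp: greaterThanLessThan_iff)
  qed
  then have "artanh p < p / q * artanh q" using l by (simp add: k_def l_def)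
  then show ?thesis using assms by (simp add: field_simps)
qed

text \<open>On the circle \<open>p\<^sup>2 + q\<^sup>2 = L\<^sup>2\<close> the product increases with \<open>p\<close> up to the diagonal: by
  \<open>artanh_ratio_less\<close> the sign of its derivative reduces to
  \<open>(q\<^sup>2 - p\<^sup>2) (1 - (p\<^sup>2 + q\<^sup>2)) \<ge> 0\<close>.\<close>

lemma artanh_mult_less:
  fixes p q L :: real
  assumes "0 < p" "p < q" "p\<^sup>2 + q\<^sup>2 = L\<^sup>2" "0 < L" "L \<le> 1"
  shows "artanh p * artanh q < (artanh (sqrt 2 / 2 * L))\<^sup>2"
proof -
  \<comment> \<open>The diagonal point of the circle is \<open>(r, r)\<close>. Below,
    \<open>s t\<close> is the second coordinate of the point with first coordinate \<open>t\<close>,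
    and \<open>t \<le> r\<close> is the arc up to the diagonal.\<close>
  define r where "r = sqrt 2 / 2 * L"
  have r2: "2 * r\<^sup>2 = L\<^sup>2" by (simp add: r_def power_mult_distrib power_divide)
  have r0: "0 < r" using assms by (simp add: r_def)
  have L1: "L\<^sup>2 \<le> 1" using assms by (simp add: abs_square_le_1)
  have "p\<^sup>2 < q\<^sup>2" using assms by (intro power_strict_mono) auto
  then have "p\<^sup>2 < r\<^sup>2" using assms r2 by linarith
  then have pr: "p < r" using r0 by (intro power_less_imp_less_base[of p 2 r]) auto
  define s where "s = (\<lambda>t. sqrt (L\<^sup>2 - t\<^sup>2))"
  have s: "0 < s t \<and> t \<le> s t \<and> s t < 1 \<and> (s t)\<^sup>2 = L\<^sup>2 - t\<^sup>2 \<and> t < 1 \<and> 0 < L\<^sup>2 - t\<^sup>2 \<and> (t < r \<longrightarrow> t < s t)"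
    if t: "0 < t" "t \<le> r" for t
  proof -
    have t2: "0 < t\<^sup>2" "t\<^sup>2 \<le> r\<^sup>2" using t by (auto intro: power_mono)
    then have pos: "0 < L\<^sup>2 - t\<^sup>2" using r2 by linarith
    then have s2: "(s t)\<^sup>2 = L\<^sup>2 - t\<^sup>2" "0 < s t" by (auto simp: s_def)
    have "t\<^sup>2 \<le> (s t)\<^sup>2" using s2 t2 r2 by linarith
    then have 1: "t \<le> s t" by (rule power2_le_imp_le) (use s2 in simp)
    have "(s t)\<^sup>2 < 1\<^sup>2" unfolding s2(1) power_one using t2(1) L1 by linarith
    then have 2: "s t < 1" by (rule power_less_imp_less_base) simp
    have "t < s t" if "t < r"
    proof -
      have "t\<^sup>2 < r\<^sup>2" using that t by (intro power_strict_mono) auto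
      then have "t\<^sup>2 < (s t)\<^sup>2" using s2 r2 by linarith
      then show ?thesis using s2(2) by (intro power_less_imp_less_base[of t 2]) auto
    qed
    with 1 2 pos s2 show ?thesis by auto
  qed
  define k where "k = (\<lambda>t. artanh t * artanh (s t))"
  have "k p < k r"
  proof (rule DERIV_pos_imp_increasing_open[OF pr, where f = k])
    fix t assume "p < t" "t < r"
    then have t: "0 < t" "t < r" using assms by auto
    define u where "u = s t"
    have u: "0 < u" "t < u" "u < 1" "u\<^sup>2 = L\<^sup>2 - t\<^sup>2" "0 < L\<^sup>2 - t\<^sup>2" "t < 1"
      using s[of t] t by (auto simp: u_def)
    have ds: "(s has_real_derivative - t / u) (at t)"
      unfolding s_def u_def using u(5)
      by (auto intro!: derivative_eq_intros simp: s_def field_simps)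
    have "(k has_real_derivative 1 / (1 - t\<^sup>2) * artanh u + 1 / (1 - u\<^sup>2) * (- t / u) * artanh t) (at t)"
      unfolding k_def u_def
      by (intro DERIV_mult artanh_real_has_field_derivative DERIV_chain2[of artanh _ s] ds[unfolded u_def])
         (use u t in \<open>auto simp: u_def\<close>)
    moreover have "0 < 1 / (1 - t\<^sup>2) * artanh u + 1 / (1 - u\<^sup>2) * (- t / u) * artanh t"
    proof -
      have "\<bar>t\<bar> < 1" "\<bar>u\<bar> < 1" using t u by auto
      then have sq1: "t\<^sup>2 < 1" "u\<^sup>2 < 1" unfolding abs_square_less_1 .
      have "t\<^sup>2 < u\<^sup>2" using t u(2) by (intro power_strict_mono) auto
      note sq = sq1 this
      have at: "0 \<le> artanh t" using artanh_real_mono[of 0 t] t u by simp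
      \<comment> \<open>For \<open>L = 1\<close> this is an equality; the strict sign of the
        derivative comes from \<open>artanh_ratio_less\<close>.\<close>
      have "0 \<le> (u\<^sup>2 - t\<^sup>2) * (1 - (u\<^sup>2 + t\<^sup>2))"
        using sq u(4) L1 by (intro mult_nonneg_nonneg) auto
      then have "t\<^sup>2 * (1 - t\<^sup>2) \<le> u\<^sup>2 * (1 - u\<^sup>2)"
        by (simp add: algebra_simps)
      \<comment> \<open>Both sides carry an extra factor \<open>t\<close>, so that
        \<open>u * artanh t < t * artanh u\<close> can be inserted; it is cancelled
        afterwards.\<close>
      then have "t * (t * (1 - t\<^sup>2) * artanh t) \<le> u * (1 - u\<^sup>2) * (u * artanh t)"
        using mult_right_mono[OF _ at, of "t\<^sup>2 * (1 - t\<^sup>2)" "u\<^sup>2 * (1 - u\<^sup>2)"]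
        by (simp add: power2_eq_square mult.left_commute mult.assoc)
      also have "\<dots> < u * (1 - u\<^sup>2) * (t * artanh u)"
        using artanh_ratio_less[OF t(1) u(2,3)] u sq by (intro mult_strict_left_mono) auto
      finally have "t * (1 - t\<^sup>2) * artanh t < u * (1 - u\<^sup>2) * artanh u"
        using t by (simp add: mult.left_commute mult.assoc)
      moreover have "1 / P * A + 1 / Q * (- t / u) * B = (u * Q * A - t * P * B) / (P * Q * u)"
        if "P \<noteq> 0" "Q \<noteq> 0" for P Q A B :: real
        using that u(1) by (simp add: field_simps)
      ultimately show ?thesis using sq u(1) by simp
    qed
    ultimately show "\<exists>y. (k has_real_derivative y) (at t) \<and> 0 < y" by blast
  next
    have "continuous_on {p..r} s" unfolding s_def by (intro continuous_intros)
    moreover have "t \<in> {-1<..<1} \<and> s t \<in> {-1<..<1}" if "t \<in> {p..r}" for t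
      using s[of t] that assms by auto
    ultimately show "continuous_on {p..r} k" unfolding k_def
      by (intro continuous_intros) auto
  qed
  moreover have "s p = q" using assms by (simp add: s_def flip: assms(3))
  moreover have "s r = r" using r0 by (simp add: s_def flip: r2)
  ultimately show ?thesis unfolding k_def r_def[symmetric] by (simp add: power2_eq_square)
qed

text \<open>Both off-diagonal cases are strict, by symmetry in \<open>p\<close> and
  \<open>q\<close>; on the diagonal both coordinates equal \<open>sqrt 2 / 2 * L\<close>.\<close>

lemma artanh_mult_le:
  fixes p q L :: real
  assumes "0 < p" "0 < q" "p\<^sup>2 + q\<^sup>2 = L\<^sup>2" "0 < L" "L \<le> 1"
  shows "artanh p * artanh q \<le> (artanh (sqrt 2 / 2 * L))\<^sup>2"
    and "artanh p * artanh q = (artanh (sqrt 2 / 2 * L))\<^sup>2 \<longleftrightarrow> p = q"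
proof -
  consider "p < q" | "p = q" | "q < p" by linarith
  then have "artanh p * artanh q \<le> (artanh (sqrt 2 / 2 * L))\<^sup>2 \<and>
    (artanh p * artanh q = (artanh (sqrt 2 / 2 * L))\<^sup>2 \<longleftrightarrow> p = q)"
  proof cases
    case 1
    then show ?thesis using artanh_mult_less[of p q L] assms by simp
  next
    case 2
    have "(sqrt 2 / 2 * L)\<^sup>2 = p\<^sup>2" using 2 assms(3) by (simp add: power_mult_distrib power_divide)
    then have "sqrt 2 / 2 * L = p" by (rule power2_eq_imp_eq) (use assms in auto)
    then show ?thesis using 2 by (simp add: power2_eq_square)
  next
    case 3
    then show ?thesis using artanh_mult_less[of q p L] assms by (simp add: mult.commute add.commute)
  qed
  then show "artanh p * artanh q \<le> (artanh (sqrt 2 / 2 * L))\<^sup>2"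
    and "artanh p * artanh q = (artanh (sqrt 2 / 2 * L))\<^sup>2 \<longleftrightarrow> p = q" by auto
qed

section \<open>Lambert quadrilaterals\<close>

text \<open>The two points range over the geodesics perpendicular to the real axis at \<open>0\<close> and at \<open>x\<close>.\<close>

lemma hyp_dist_perpendiculars:
  fixes x s t :: real
  assumes "\<bar>x\<bar> < 1" "\<bar>s\<bar> < 1" "\<bar>t\<bar> < 1"
  shows "2 * artanh \<bar>x\<bar> \<le> hyp_dist (\<i> * of_real s) (Moebius_function 0 (- of_real x) (\<i> * of_real t))"
proof -
  define z where "z = Moebius_function 0 (- of_real x) (\<i> * of_real t)"
  define q where "q = 1 + of_real x * (\<i> * of_real t)"
  define \<delta> where "\<delta> = cmod (Moebius_function 0 (\<i> * of_real s) z)"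
  have nt: "cmod (\<i> * of_real t) < 1" and ns: "cmod (\<i> * of_real s) < 1" and nx: "cmod (- of_real x) < 1"
    using assms by (auto simp: norm_mult)
  have q0: "q \<noteq> 0"
    using Moebius_denom_nonzero[OF nx, of "\<i> * of_real t"] nt by (simp add: q_def)
  have z1: "cmod z < 1" using nt nx by (simp add: z_def Moebius_norm_less_iff)
  have d1: "\<delta> < 1" unfolding \<delta>_def using z1 ns by (simp add: Moebius_norm_less_iff)
  \<comment> \<open>These are chosen to give \<open>1 - \<delta>^2 = (1 - x^2) * (P / R)\<close>. As
    \<open>R - P\<close> is a sum of squares, \<open>P / R \<le> 1\<close>, and hence
    \<open>\<delta>\<close> is at least \<open>|x|\<close>.\<close>
  define P where "P = (1 - s\<^sup>2) * (1 - t\<^sup>2)"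
  define R where "R = (1 - s * t)\<^sup>2 + x\<^sup>2 * (s + t)\<^sup>2"
  have sq: "s\<^sup>2 < 1" "t\<^sup>2 < 1" "x\<^sup>2 < 1" using assms by (simp_all add: abs_square_less_1)
  then have P0: "0 < P" by (simp add: P_def)
  have "R - P = (s - t)\<^sup>2 + x\<^sup>2 * (s + t)\<^sup>2"
    unfolding R_def P_def by (simp add: power2_eq_square algebra_simps)
  moreover have "0 \<le> (s - t)\<^sup>2 + x\<^sup>2 * (s + t)\<^sup>2" by simp
  ultimately have PR: "P \<le> R" by linarith
  have A: "1 - (cmod z)\<^sup>2 = (1 - x\<^sup>2) * (1 - t\<^sup>2) / (cmod q)\<^sup>2"
    using one_minus_norm_Moebius[OF nx, of "\<i> * of_real t" 0] nt
    by (simp add: z_def q_def norm_mult)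
  have "z = (\<i> * of_real t + of_real x) / q"
    by (simp add: z_def q_def Moebius_function_def)
  then have "1 - cnj (\<i> * of_real s) * z = (q + \<i> * of_real s * (\<i> * of_real t + of_real x)) / q"
    using q0 by (simp add: add_divide_distrib distrib_left)
  also have "q + \<i> * of_real s * (\<i> * of_real t + of_real x) = of_real (1 - s * t) + \<i> * of_real (x * (s + t))"
    by (simp add: q_def complex_eq_iff algebra_simps)
  finally have "(cmod (1 - cnj (\<i> * of_real s) * z))\<^sup>2 =
      (cmod (of_real (1 - s * t) + \<i> * of_real (x * (s + t))))\<^sup>2 / (cmod q)\<^sup>2"
    by (simp only: norm_divide power_divide)
  also have "(cmod (of_real (1 - s * t) + \<i> * of_real (x * (s + t))))\<^sup>2 = R"
    unfolding cmod_power2 R_def by (simp add: power_mult_distrib)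
  finally have B: "(cmod (1 - cnj (\<i> * of_real s) * z))\<^sup>2 = R / (cmod q)\<^sup>2" .
  have "1 - \<delta>\<^sup>2 = (1 - s\<^sup>2) * (1 - (cmod z)\<^sup>2) / (cmod (1 - cnj (\<i> * of_real s) * z))\<^sup>2"
    using one_minus_norm_Moebius[OF ns, of z 0] z1 by (simp add: \<delta>_def norm_mult)
  also have "\<dots> = (1 - x\<^sup>2) * (P / R)"
    unfolding A B P_def using q0 by (simp add: mult_ac)
  also have "\<dots> \<le> (1 - x\<^sup>2) * 1"
    using P0 PR sq by (intro mult_left_mono) auto
  finally have "\<bar>x\<bar>\<^sup>2 \<le> \<delta>\<^sup>2" by simp
  then have "\<bar>x\<bar> \<le> \<delta>" by (rule power2_le_imp_le) (simp add: \<delta>_def)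
  then have "artanh \<bar>x\<bar> \<le> artanh \<delta>" by (intro artanh_real_mono) (use d1 in auto)
  then show ?thesis by (simp add: hyp_dist_eq \<delta>_def z_def)
qed

section \<open>Distances between opposite sides of a Lambert quadrilateral\<close>

lemma hyp_setdist_eqI:
  assumes "a \<in> A" "b \<in> B" "hyp_dist a b = r"
    "\<And>x y. x \<in> A \<Longrightarrow> y \<in> B \<Longrightarrow> r \<le> hyp_dist x y"
  shows "hyp_setdist A B = r"
  unfolding hyp_setdist_def using assms by (intro cInf_eq_minimum) blast+

lemma hyp_setdist_Moebius:
  assumes "cmod a < 1" "A \<subseteq> ball 0 1" "B \<subseteq> ball 0 1"
  shows "hyp_setdist (Moebius_function t a ` A) (Moebius_function t a ` B) = hyp_setdist A B"
proof -
  let ?T = "Moebius_function t a"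
  have *: "hyp_dist (?T x) (?T y) = hyp_dist x y" if "x \<in> A" "y \<in> B" for x y
    using that assms by (intro hyp_dist_Moebius) auto
  have "{hyp_dist x y |x y. x \<in> ?T ` A \<and> y \<in> ?T ` B} = {hyp_dist (?T x) (?T y) |x y. x \<in> A \<and> y \<in> B}"
    by blast
  also have "\<dots> = {hyp_dist x y |x y. x \<in> A \<and> y \<in> B}"
    using * by (auto intro!: Collect_cong ex_cong1)
  finally show ?thesis by (simp add: hyp_setdist_def)
qed

lemma hyp_seg_commute: "hyp_seg a b = hyp_seg b a"
  unfolding hyp_seg_def by blast

text \<open>The quotient of the two directions has norm 1 and argument \<open>pi / 2\<close>, so it
  is \<open>\<i>\<close>. This turns each right angle into an algebraic equation.\<close>

lemma interior_angle_right:
  assumes "interior_angle p v n = pi / 2"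
    "cmod v < 1" "cmod p \<le> 1" "cmod n \<le> 1" "p \<noteq> v" "n \<noteq> v"
  shows "sgn (Moebius_function 0 v p) = \<i> * sgn (Moebius_function 0 v n)"
proof -
  define w where "w = sgn (Moebius_function 0 v p) / sgn (Moebius_function 0 v n)"
  have nz: "Moebius_function 0 v p \<noteq> 0" "Moebius_function 0 v n \<noteq> 0"
    using hyp_seg_eq_Moebius(1) assms by blast+
  then have "cmod w = 1" by (simp add: w_def norm_divide norm_sgn)
  moreover have "Arg2pi w = pi / 2"
    using assms by (simp add: interior_angle_def w_def hyp_dir_eq)
  moreover have "w = of_real (cmod w) * cis (Arg2pi w)"
    using Arg2pi[of w] unfolding is_Arg_def cis_conv_exp by blast
  ultimately have "w = \<i>" by (metis cis_pi_half mult_1 of_real_1)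
  then show ?thesis using nz by (simp add: w_def divide_eq_eq sgn_zero_iff)
qed

text \<open>The right angles at \<open>x\<close> and \<open>d\<close> say that \<open>c\<close>
  becomes purely imaginary when \<open>x\<close> is moved to 0, and real when \<open>d\<close> is.
  These two equations determine the Klein coordinates of \<open>c\<close> from \<open>x\<close> and
  \<open>|d|\<close>.\<close>

lemma normalised_lambert:
  fixes x :: real and c d :: complex
  assumes x: "0 < x" "x < 1" and c: "cmod c \<le> 1" and d: "cmod d < 1" "d \<noteq> 0"
    and distinct: "c \<noteq> of_real x" "c \<noteq> d"
    and angles: "interior_angle d 0 (of_real x) = pi / 2" "interior_angle 0 (of_real x) c = pi / 2"
      "interior_angle c d 0 = pi / 2"
  shows "0 < Re c" "0 < Im c"
    "hyp_setdist (hyp_seg 0 d) (hyp_seg (of_real x) c) = artanh (2 * Re c / (1 + (cmod c)\<^sup>2))"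
    "hyp_setdist (hyp_seg 0 (of_real x)) (hyp_seg c d) = artanh (2 * Im c / (1 + (cmod c)\<^sup>2))"
proof -
  have nx: "cmod (of_real x) < 1" and x0: "of_real x \<noteq> (0 :: complex)" using x by auto
  define y where "y = cmod d"
  define k where "k = cmod (Moebius_function 0 (of_real x) c)"
  define l where "l = cmod (Moebius_function 0 d c)"
  have y: "0 < y" "y < 1" using d by (auto simp: y_def)
  have "sgn d = \<i>"
    using interior_angle_right[OF angles(1)] x d by (simp add: Moebius_function_def sgn_of_real)
  then have dy: "d = \<i> * of_real y"
    using d by (simp add: y_def sgn_eq field_simps)
  have "sgn (Moebius_function 0 (of_real x) 0) = \<i> * sgn (Moebius_function 0 (of_real x) c)"
    using interior_angle_right[OF angles(2) nx] c x0 distinct by simp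
  moreover have "sgn (Moebius_function 0 (of_real x) 0) = - 1"
    using x by (simp add: Moebius_function_def sgn_minus sgn_of_real)
  ultimately have "sgn (Moebius_function 0 (of_real x) c) = \<i>"
    by (metis complex_i_mult_minus minus_minus mult_minus_right mult.right_neutral)
  then have xc: "Moebius_function 0 (of_real x) c = \<i> * of_real k"
    using hyp_seg_eq_Moebius(1)[OF nx c distinct(1)] by (simp add: k_def sgn_eq field_simps)
  have "sgn (Moebius_function 0 d c) = \<i> * sgn (Moebius_function 0 d 0)"
    using interior_angle_right[OF angles(3)] c d distinct by simp
  also have "sgn (Moebius_function 0 d 0) = - \<i>"
    using \<open>sgn d = \<i>\<close> by (simp add: Moebius_function_def sgn_minus)
  finally have "sgn (Moebius_function 0 d c) = 1" by simp
  then have dc: "Moebius_function 0 d c = of_real l"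
    using hyp_seg_eq_Moebius(1)[OF d(1) c distinct(2)] by (simp add: l_def sgn_eq field_simps)
  have kl: "0 < k" "0 < l"
    using hyp_seg_eq_Moebius(1)[OF nx c distinct(1)] hyp_seg_eq_Moebius(1)[OF d(1) c distinct(2)]
    by (auto simp: k_def l_def)
  have kl1: "k \<le> 1" "l \<le> 1" unfolding k_def l_def
    using Moebius_norm_less_iff nx c d by auto
  have "c - of_real x = \<i> * of_real k * (1 - of_real x * c)"
    using xc Moebius_denom_nonzero[OF nx c] by (simp add: Moebius_function_def field_simps)
  then have 1: "Re c - x = k * x * Im c" "Im c = k * (1 - x * Re c)"
    by (auto simp: complex_eq_iff algebra_simps)
  have "c - d = of_real l * (1 + \<i> * of_real y * c)"
    using dc Moebius_denom_nonzero[OF d(1) c] by (simp add: Moebius_function_def dy field_simps)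
  then have 2: "Im c - y = l * y * Re c" "Re c = l * (1 - y * Im c)"
    by (auto simp: complex_eq_iff dy algebra_simps)
  have "\<bar>Re c\<bar> \<le> 1" "\<bar>Im c\<bar> \<le> 1" using c abs_Re_le_cmod abs_Im_le_cmod order_trans by blast+
  then have "x * Re c \<le> x * 1" "y * Im c \<le> y * 1" using x y by (auto intro!: mult_left_mono)
  then have "0 < 1 - x * Re c" "0 < 1 - y * Im c" using x y by linarith+
  then have "0 < k * (1 - x * Re c)" "0 < l * (1 - y * Im c)" using kl by simp_all
  then show "0 < Re c" "0 < Im c" unfolding 1(2)[symmetric] 2(2)[symmetric] by blast+
  have c0: "0 < 1 + (cmod c)\<^sup>2" "0 < 1 + x\<^sup>2" "0 < 1 + y\<^sup>2" by (simp_all add: add_pos_nonneg)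
  \<comment> \<open>Eliminating \<open>k\<close> shows that \<open>c\<close> and \<open>x\<close>
    have the same Klein abscissa, which is constant along the perpendicular at \<open>x\<close>. The
    computation for \<open>y\<close> is the same with the axes exchanged.\<close>
  have "Re c * (1 + x\<^sup>2) - x * (1 + (cmod c)\<^sup>2) = (Re c - x) * (1 - x * Re c) - x * Im c * Im c"
    unfolding cmod_power2 by (simp add: power2_eq_square algebra_simps)
  also have "\<dots> = x * Im c * (k * (1 - x * Re c)) - x * Im c * Im c" unfolding 1(1) by simp
  also have "\<dots> = 0" unfolding 1(2)[symmetric] by simp
  finally have "2 * x / (1 + x\<^sup>2) = 2 * Re c / (1 + (cmod c)\<^sup>2)"
    using c0 by (simp add: divide_eq_eq eq_divide_eq algebra_simps)
  then have ax: "2 * artanh x = artanh (2 * Re c / (1 + (cmod c)\<^sup>2))"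
    using artanh_double[of x] x by simp
  have "Im c * (1 + y\<^sup>2) - y * (1 + (cmod c)\<^sup>2) = (Im c - y) * (1 - y * Im c) - y * Re c * Re c"
    unfolding cmod_power2 by (simp add: power2_eq_square algebra_simps)
  also have "\<dots> = y * Re c * (l * (1 - y * Im c)) - y * Re c * Re c" unfolding 2(1) by simp
  also have "\<dots> = 0" unfolding 2(2)[symmetric] by simp
  finally have "2 * y / (1 + y\<^sup>2) = 2 * Im c / (1 + (cmod c)\<^sup>2)"
    using c0 by (simp add: divide_eq_eq eq_divide_eq algebra_simps)
  then have ay: "2 * artanh y = artanh (2 * Im c / (1 + (cmod c)\<^sup>2))"
    using artanh_double[of y] y by simp
  \<comment> \<open>Each side is parametrised by a real \<open>s\<close> along the diameter that
    carries it once one end is at 0. Ideal points are not in \<open>hyp_seg\<close>, whence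
    \<open>|s| < 1\<close>.\<close>
  have seg_d: "\<exists>s. \<bar>s\<bar> < 1 \<and> z = \<i> * of_real s" if "z \<in> hyp_seg 0 d" for z
  proof -
    have "z \<in> closed_segment 0 d" "cmod z < 1" using that d by (auto simp: hyp_seg_zero)
    then obtain s where "z = \<i> * of_real (s * y)" by (auto simp: in_segment dy scaleR_conv_of_real mult_ac)
    with \<open>cmod z < 1\<close> show ?thesis by (intro exI[of _ "s * y"]) (simp add: norm_mult abs_mult)
  qed
  have seg_x: "\<exists>s. \<bar>s\<bar> < 1 \<and> z = of_real s" if "z \<in> hyp_seg 0 (of_real x)" for z
  proof -
    have "z \<in> closed_segment 0 (of_real x)" "cmod z < 1" using that x nx by (auto simp: hyp_seg_zero)
    then obtain s where "z = of_real (s * x)" by (auto simp: in_segment scaleR_conv_of_real)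
    with \<open>cmod z < 1\<close> show ?thesis by (intro exI[of _ "s * x"]) (simp add: norm_mult abs_mult)
  qed
  have seg_xc: "\<exists>s. \<bar>s\<bar> < 1 \<and> z = Moebius_function 0 (- of_real x) (\<i> * of_real s)"
    if z: "z \<in> hyp_seg (of_real x) c" for z
  proof -
    obtain w where w: "z = Moebius_function 0 (- of_real x) w" "w \<in> closed_segment 0 (\<i> * of_real k)" "cmod w < 1"
      using z unfolding hyp_seg_eq_Moebius(2)[OF nx c distinct(1)] xc by auto
    then obtain s where "w = \<i> * of_real (s * k)" by (auto simp: in_segment scaleR_conv_of_real mult_ac)
    with w show ?thesis by (intro exI[of _ "s * k"]) (simp add: norm_mult abs_mult)
  qed
  have seg_dc: "\<exists>s. \<bar>s\<bar> < 1 \<and> z = Moebius_function 0 (- d) (of_real s)"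
    if z: "z \<in> hyp_seg d c" for z
  proof -
    obtain w where w: "z = Moebius_function 0 (- d) w" "w \<in> closed_segment 0 (of_real l)" "cmod w < 1"
      using z unfolding hyp_seg_eq_Moebius(2)[OF d(1) c distinct(2)] dc by auto
    then obtain s where "w = of_real (s * l)" by (auto simp: in_segment scaleR_conv_of_real)
    with w show ?thesis by (intro exI[of _ "s * l"]) (simp add: norm_mult abs_mult)
  qed
  have start: "p \<in> hyp_seg p q" if "cmod p < 1" "cmod q \<le> 1" "q \<noteq> p" for p q
    unfolding hyp_seg_def using that by auto
  show "hyp_setdist (hyp_seg 0 d) (hyp_seg (of_real x) c) = artanh (2 * Re c / (1 + (cmod c)\<^sup>2))"
    unfolding ax[symmetric]
  proof (rule hyp_setdist_eqI)
    show "0 \<in> hyp_seg 0 d" "of_real x \<in> hyp_seg (of_real x) c"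
      using start d nx c distinct by auto
    show "hyp_dist 0 (of_real x) = 2 * artanh x"
      using x by (simp add: hyp_dist_eq Moebius_function_def)
    fix z w assume "z \<in> hyp_seg 0 d" "w \<in> hyp_seg (of_real x) c"
    then obtain s t where "\<bar>s\<bar> < 1" "z = \<i> * of_real s" "\<bar>t\<bar> < 1"
      "w = Moebius_function 0 (- of_real x) (\<i> * of_real t)"
      using seg_d seg_xc by blast
    then show "2 * artanh x \<le> hyp_dist z w"
      using hyp_dist_perpendiculars[of x s t] x by simp
  qed
  \<comment> \<open>The quarter turn by \<open>\<i>\<close> brings the other pair of sides into the
    position of \<open>hyp_dist_perpendiculars\<close>, with foot \<open>- y\<close>; hence the
    absolute value in that lemma.\<close>
  have rot: "\<i> * Moebius_function 0 (- d) (of_real s) = Moebius_function 0 (- of_real (- y)) (\<i> * of_real s)" for s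
    by (simp add: Moebius_function_def dy algebra_simps)
  show "hyp_setdist (hyp_seg 0 (of_real x)) (hyp_seg c d) = artanh (2 * Im c / (1 + (cmod c)\<^sup>2))"
    unfolding ay[symmetric] hyp_seg_commute[of c d]
  proof (rule hyp_setdist_eqI)
    show "0 \<in> hyp_seg 0 (of_real x)" "d \<in> hyp_seg d c"
      using start d nx c distinct x by auto
    show "hyp_dist 0 d = 2 * artanh y"
      by (simp add: hyp_dist_eq Moebius_function_def y_def)
    fix z w assume "z \<in> hyp_seg 0 (of_real x)" "w \<in> hyp_seg d c"
    then obtain s t where st: "\<bar>s\<bar> < 1" "z = of_real s" "\<bar>t\<bar> < 1" "w = Moebius_function 0 (- d) (of_real t)"
      using seg_x seg_dc by blast
    have "2 * artanh \<bar>- y\<bar> \<le> hyp_dist (\<i> * of_real s) (Moebius_function 0 (- of_real (- y)) (\<i> * of_real t))"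
      by (rule hyp_dist_perpendiculars) (use st y in auto)
    also have "\<dots> = hyp_dist (\<i> * z) (\<i> * w)" by (simp only: rot st)
    also have "\<dots> = hyp_dist z w" by (simp add: hyp_dist_def norm_mult flip: right_diff_distrib)
    finally show "2 * artanh y \<le> hyp_dist z w" using y by simp
  qed
qed

section \<open>Reduction of a general quadrilateral to the normalised position\<close>

theorem theorem1p1:
  fixes va vb vc vd :: complex and \<phi> d1 d2 L :: real
  assumes "lambert_quadrilateral va vb vc vd \<phi>"
    and "d1 = hyp_setdist (hyp_seg va vd) (hyp_seg vb vc)"
    and "d2 = hyp_setdist (hyp_seg va vb) (hyp_seg vc vd)"
    and "L = tanh_hyp_dist va vc"
  shows "0 < L \<and> L \<le> 1 \<and>
    d1 * d2 \<le> (artanh (sqrt 2 / 2 * L))\<^sup>2 \<and>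
    (d1 * d2 = (artanh (sqrt 2 / 2 * L))\<^sup>2 \<longleftrightarrow> vc \<in> interior_bisector vd va vb)"
proof -
  have quad: "hyp_quadrilateral va vb vc vd"
    and angles: "interior_angle vd va vb = pi / 2" "interior_angle va vb vc = pi / 2"
      "interior_angle vc vd va = pi / 2"
    and a: "cmod va < 1" and b: "cmod vb < 1" and d: "cmod vd < 1"
    using assms(1) by (auto simp: lambert_quadrilateral_def)
  have c: "cmod vc \<le> 1" using quad by (simp add: hyp_quadrilateral_def)
  have "x \<noteq> y" if "side_path g x y" for g x y
    using that arc_distinct_ends unfolding side_path_def by metis
  then have distinct: "va \<noteq> vb" "vb \<noteq> vc" "vc \<noteq> vd" "vd \<noteq> va"
    using quad unfolding hyp_quadrilateral_def by blast+
  \<comment> \<open>The rotation cancels the argument of the image of \<open>vb\<close>, which puts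
    \<open>T vb\<close> on the positive real axis.\<close>
  define t where "t = - Arg (Moebius_function 0 va vb)"
  define T where "T = Moebius_function t va"
  define x where "x = cmod (Moebius_function 0 va vb)"
  have x: "0 < x" "x < 1"
    using hyp_seg_eq_Moebius(1)[of va vb] a b distinct by (auto simp: x_def Moebius_norm_less_iff)
  have Ta: "T va = 0" by (simp add: T_def Moebius_function_eq_zero)
  have "T vb = exp (\<i> * of_real t) * Moebius_function 0 va vb"
    by (simp add: T_def Moebius_function_def)
  also have "\<dots> = exp (\<i> * of_real t) * (of_real x * exp (\<i> * of_real (- t)))"
    using Arg_eq[of "Moebius_function 0 va vb"] x by (simp add: x_def t_def)
  also have "\<dots> = of_real x" by (simp add: exp_minus)
  finally have Tb: "T vb = of_real x" .
  define C where "C = T vc"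
  have Tinj: "T p \<noteq> T q" if "cmod p \<le> 1" "cmod q \<le> 1" "p \<noteq> q" for p q
    using that Moebius_inverse[OF a, of p t] Moebius_inverse[OF a, of q t] unfolding T_def by metis
  have C1: "cmod C \<le> 1" "cmod C = 1 \<longleftrightarrow> cmod vc = 1"
    using Moebius_norm_less_iff[OF a c, of t] c by (auto simp: C_def T_def)
  have Td: "cmod (T vd) < 1" using Moebius_norm_less_iff[OF a, of vd t] d by (simp add: T_def)
  have Tdist: "T vd \<noteq> 0" "C \<noteq> of_real x" "C \<noteq> T vd"
    using Tinj[of vd va] Tinj[of vb vc] Tinj[of vc vd] a b c d distinct Ta Tb by (auto simp: C_def)
  have Tangles: "interior_angle (T vd) 0 (of_real x) = pi / 2" "interior_angle 0 (of_real x) C = pi / 2"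
      "interior_angle C (T vd) 0 = pi / 2"
    using interior_angle_Moebius[OF a, of va vd vb t] interior_angle_Moebius[OF a, of vb va vc t]
      interior_angle_Moebius[OF a, of vd vc va t] angles a b c d distinct Ta Tb
    by (auto simp: C_def simp flip: T_def)
  note normal = normalised_lambert[OF x C1(1) Td Tdist Tangles]
  have Tseg: "hyp_setdist (hyp_seg (T p) (T q)) (hyp_seg (T p') (T q')) = hyp_setdist (hyp_seg p q) (hyp_seg p' q')"
    if "cmod p \<le> 1" "cmod q \<le> 1" "cmod p' \<le> 1" "cmod q' \<le> 1" for p q p' q'
    unfolding T_def hyp_seg_Moebius[OF a that(1,2)] hyp_seg_Moebius[OF a that(3,4)]
    by (intro hyp_setdist_Moebius a) (auto simp: hyp_seg_def)
  define N where "N = 1 + (cmod C)\<^sup>2"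
  have N: "0 < N" by (simp add: N_def add_pos_nonneg)
  have d1: "d1 = artanh (2 * Re C / N)"
    using Tseg[of va vd vb vc] normal(3) a b c d by (simp add: assms(2) Ta Tb C_def N_def)
  have d2: "d2 = artanh (2 * Im C / N)"
    using Tseg[of va vb vc vd] normal(4) a b c d by (simp add: assms(3) Ta Tb C_def N_def)
  \<comment> \<open>\<open>L\<close> is the Klein radius of \<open>C\<close>. For ideal
    \<open>vc\<close> this gives \<open>2 / 2 = 1\<close>, in agreement with the convention for
    infinite distance.\<close>
  have L: "L = 2 * cmod C / N"
  proof (cases "cmod vc = 1")
    case True
    then show ?thesis using C1 by (simp add: assms(4) tanh_hyp_dist_def N_def)
  next
    case False
    then have C2: "cmod C < 1" using C1 by simp
    have "\<bar>2 * cmod C / N\<bar> < 1"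
    proof -
      have "0 < (1 - cmod C)\<^sup>2" using C2 by simp
      then have "2 * cmod C < N" by (simp add: N_def power2_eq_square algebra_simps)
      then show ?thesis using N by simp
    qed
    moreover have "hyp_dist va vc = hyp_dist 0 C"
      using hyp_dist_Moebius[OF a a c, of t] Ta by (simp add: C_def T_def)
    moreover have "hyp_dist 0 C = artanh (2 * cmod C / N)"
      using artanh_double[of "cmod C"] C2 by (simp add: hyp_dist_eq Moebius_function_def N_def)
    ultimately show ?thesis using False by (simp add: assms(4) tanh_hyp_dist_def tanh_artanh_real)
  qed
  have C0: "C \<noteq> 0" using normal(1) by auto
  have "0 \<le> (1 - cmod C)\<^sup>2" by simp
  then have "2 * cmod C \<le> N" by (simp add: N_def power2_eq_square algebra_simps)
  then have L01: "0 < L" "L \<le> 1" using N C0 by (auto simp: L)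
  have "(2 * Re C / N)\<^sup>2 + (2 * Im C / N)\<^sup>2 = L\<^sup>2"
    unfolding L power_divide power_mult_distrib cmod_power2
    by (simp add: add_divide_distrib distrib_left)
  note bound = artanh_mult_le[OF _ _ this L01]
  have pq: "0 < 2 * Re C / N" "0 < 2 * Im C / N" using normal(1,2) N by auto
  have ca: "vc \<noteq> va" using C0 Ta by (auto simp: C_def)
  obtain u where u: "cmod u = 1"
    "\<And>y. cmod y \<le> 1 \<Longrightarrow> y \<noteq> va \<Longrightarrow> hyp_dir (T va) (T y) = u * hyp_dir va y"
    using hyp_dir_Moebius[OF a a, of t] unfolding T_def by blast
  then have u0: "u \<noteq> 0" by auto
  \<comment> \<open>The bisector makes the angle \<open>pi / 4\<close> with the side towards
    \<open>vb\<close>. After \<open>T\<close> that side points along 1, so the condition says that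
    \<open>C\<close> lies on the diagonal.\<close>
  have "hyp_dir va vc = hyp_dir va vb * cis (pi / 4) \<longleftrightarrow> u * hyp_dir va vc = u * hyp_dir va vb * cis (pi / 4)"
    using u0 by simp
  also have "u * hyp_dir va vc = sgn C"
    using u(2)[OF c ca] hyp_dir_eq[of 0 C] C1 C0 Ta by (simp add: C_def Moebius_function_def)
  also have "u * hyp_dir va vb = 1"
    using u(2)[of vb] hyp_dir_eq[of 0 "of_real x"] b distinct x Ta Tb
    by (simp add: Moebius_function_def sgn_of_real)
  also have "sgn C = 1 * cis (pi / 4) \<longleftrightarrow> Re C = Im C"
  proof
    assume "sgn C = 1 * cis (pi / 4)"
    then have "C = of_real (cmod C) * cis (pi / 4)" using C0 by (simp add: sgn_eq field_simps)
    from arg_cong[OF this, of Re] arg_cong[OF this, of Im] show "Re C = Im C"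
      by (simp add: sin_45 cos_45)
  next
    assume eq: "Re C = Im C"
    have "cmod C = sqrt 2 * Re C"
      using normal(1) eq by (simp add: cmod_def real_sqrt_mult flip: mult_2)
    then show "sgn C = 1 * cis (pi / 4)"
      using normal(1) eq by (simp add: complex_eq_iff sgn_eq cos_45 sin_45 Re_divide_of_real Im_divide_of_real field_simps)
  qed
  finally have "vc \<in> interior_bisector vd va vb \<longleftrightarrow> Re C = Im C"
    using ca c by (simp add: interior_bisector_def angles(1))
  moreover have "2 * Re C / N = 2 * Im C / N \<longleftrightarrow> Re C = Im C" using N by simp
  ultimately show ?thesis using L01 bound[OF pq] unfolding d1 d2 by blast
qed

end
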